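(* Let $\epsilon \in \{1,-1\}$ and $s \in \{1,-1\}$, and let $a,b$ be integers. If $a > b \geq 0$, then, as formal power series in $q$, $$\Psi(s q^a, s\epsilon q^b) = \Psi(\epsilon q^{3a+b}, \epsilon q^{a+3b}) - s\epsilon\, q^b\, \Psi(\epsilon q^{3a+5b}, \epsilon q^{a-b}).$$ If instead $b > a \geq 0$, then $$\Psi(s q^a, s\epsilon q^b) = \Psi(\epsilon q^{3a+b}, \epsilon q^{a+3b}) + s\, q^a\, \Psi(\epsilon q^{5a+3b}, \epsilon q^{b-a}).$$
   Context: The false theta function is the formal power series in $q$, for $x,y$ each of the form $\pm q^m$ with integer $m \ge 0$ (the two exponents not both zero), given by $$\Psi(x,y) := \sum_{n=0}^\infty x^{\binom{n+1}{2}} y^{\binom{n}{2}} - \sum_{n=-\infty}^{-1} x^{\binom{n+1}{2}} y^{\binom{n}{2}},$$ where for every integer $n$, $\binom{n+1}{2} = n(n+1)/2$ and $\binom{n}{2} = n(n-1)/2$. *)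

theory Defs
  imports "HOL-Analysis.Infinite_Sum" "HOL-Computational_Algebra.Formal_Power_Series"
begin

text \<open>
  The variable \<open>q\<close> is \<^const>\<open>fps_X\<close>. The exponent of \<open>signed_qpow\<close> is an integer so that
  expressions such as \<open>a - b\<close> need no truncated subtraction; only exponents \<open>m \<ge> 0\<close> are meaningful.
\<close>

definition signed_qpow :: "int \<Rightarrow> int \<Rightarrow> int fps" where
  "signed_qpow s m = fps_const s * fps_X ^ nat m"

text \<open>
  In \<open>Psi_term\<close> both divisions are exact and both exponents are nonnegative for every integer \<open>n\<close>.
  The sums in \<open>Psi\<close> refer to the \<open>q\<close>-adic topology on formal power series. By
  \<open>Psi_term_summable\<close> below they converge for \<open>x = \<plusminus>q^k\<close> and \<open>y = \<plusminus>q^l\<close> with \<open>k, l \<ge> 0\<close> not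
  both zero, the intended domain of \<open>Psi\<close>; elsewhere its value carries no meaning.
\<close>

definition Psi_term :: "int fps \<Rightarrow> int fps \<Rightarrow> int \<Rightarrow> int fps" where
  "Psi_term x y n = x ^ nat (n * (n + 1) div 2) * y ^ nat (n * (n - 1) div 2)"

definition Psi :: "int fps \<Rightarrow> int fps \<Rightarrow> int fps" where
  "Psi x y = (\<Sum>\<^sub>\<infinity>n\<in>{0..}. Psi_term x y n) - (\<Sum>\<^sub>\<infinity>n\<in>{..-1}. Psi_term x y n)"

lemma Psi_term_signed_qpow:
  "Psi_term (signed_qpow s k) (signed_qpow t l) n =
     fps_const (s ^ nat (n * (n + 1) div 2) * t ^ nat (n * (n - 1) div 2)) *
     fps_X ^ (nat k * nat (n * (n + 1) div 2) + nat l * nat (n * (n - 1) div 2))"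
  unfolding Psi_term_def signed_qpow_def
  by (simp add: power_mult_distrib fps_const_power power_add flip: power_mult fps_const_mult)

lemma triangular_ge:
  fixes n :: int
  shows "n * (n + 1) div 2 \<ge> \<bar>n\<bar> - 1" and "n * (n - 1) div 2 \<ge> \<bar>n\<bar> - 1"
proof -
  have "(\<bar>n\<bar> - 1) * (\<bar>n\<bar> - 2) \<ge> 0"
    by (cases "\<bar>n\<bar> \<ge> 2"; cases "\<bar>n\<bar> = 1"; cases "n = 0") auto
  then have "2 * (\<bar>n\<bar> - 1) \<le> n * (n + 1)" "2 * (\<bar>n\<bar> - 1) \<le> n * (n - 1)"
    by (cases "n \<ge> 0"; simp add: algebra_simps)+
  from this[THEN zdiv_mono1, of 2]
  show "n * (n + 1) div 2 \<ge> \<bar>n\<bar> - 1" "n * (n - 1) div 2 \<ge> \<bar>n\<bar> - 1"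
    by simp_all
qed

lemma Psi_term_coeff_eq_0:
  assumes "k \<ge> 0" "l \<ge> 0" "k \<noteq> 0 \<or> l \<noteq> 0" and "\<bar>n\<bar> > int j + 1"
  shows "fps_nth (Psi_term (signed_qpow s k) (signed_qpow t l) n) j = 0"
proof -
  let ?u = "nat (n * (n + 1) div 2)" and ?v = "nat (n * (n - 1) div 2)"
  have uv: "?u > j" "?v > j"
    using triangular_ge[of n] assms(4) by linarith+
  have "nat k \<ge> 1 \<or> nat l \<ge> 1"
    using assms by linarith
  then have "nat k * ?u + nat l * ?v > j"
  proof
    assume "nat k \<ge> 1"
    then have "?u \<le> nat k * ?u" by simp
    with uv show ?thesis by linarith
  next
    assume "nat l \<ge> 1"
    then have "?v \<le> nat l * ?v" by simp
    with uv show ?thesis by linarith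
  qed
  then show ?thesis
    by (simp add: Psi_term_signed_qpow)
qed

lemma Psi_term_summable:
  assumes "k \<ge> 0" "l \<ge> 0" "k \<noteq> 0 \<or> l \<noteq> 0"
  shows "Psi_term (signed_qpow s k) (signed_qpow t l) summable_on A"
proof -
  let ?f = "Psi_term (signed_qpow s k) (signed_qpow t l)"
  let ?B = "\<lambda>j. A \<inter> {- (int j + 1)..int j + 1}"
  let ?L = "Abs_fps (\<lambda>j. \<Sum>n\<in>?B j. fps_nth (?f n) j)"
  have "(sum ?f \<longlongrightarrow> ?L) (finite_subsets_at_top A)"
    unfolding tendsto_fps_iff
  proof
    fix j
    show "\<forall>\<^sub>F S in finite_subsets_at_top A. fps_nth (sum ?f S) j = fps_nth ?L j"
      unfolding eventually_finite_subsets_at_top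
    proof (intro exI[of _ "?B j"] conjI allI impI)
      fix S assume S: "finite S \<and> ?B j \<subseteq> S \<and> S \<subseteq> A"
      have "(\<Sum>n\<in>S. fps_nth (?f n) j) = (\<Sum>n\<in>?B j. fps_nth (?f n) j)"
      proof (rule sum.mono_neutral_right)
        show "\<forall>n\<in>S - ?B j. fps_nth (?f n) j = 0"
          using S by (auto intro!: Psi_term_coeff_eq_0[OF assms])
      qed (use S in auto)
      then show "fps_nth (sum ?f S) j = fps_nth ?L j"
        by (simp add: fps_sum_nth)
    qed auto
  qed
  then show ?thesis
    unfolding summable_on_def has_sum_def by blast
qed

end

theory Submission
  imports Defs
begin

text \<open>
  Split the bilateral sum on the left according to the parity of the index \<open>n\<close>. The terms with
  \<open>n = 2m\<close> are, sign for sign, those of the first \<open>\<Psi>\<close> on the right. The terms with odd \<open>n\<close> are those of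
  the second \<open>\<Psi>\<close>, times the prefactor, where \<open>n = 2m + 1\<close> if \<open>b > a\<close> and \<open>n = - 2m - 1\<close> if \<open>a > b\<close>;
  the latter substitution interchanges the two half-lines, hence the minus sign.
\<close>

text \<open>In the q-adic topology a net converges when each coefficient is eventually constant,
  which is convergence in the discrete topology of the coefficients. Additivity of
  \<open>has_sum\<close> can thus be carried over from integers to power series.\<close>

lemma has_sum_fps_iff:
  fixes f :: "'a \<Rightarrow> 'b :: {discrete_topology, ab_group_add} fps"
  shows "(f has_sum S) A \<longleftrightarrow> (\<forall>j. ((\<lambda>n. fps_nth (f n) j) has_sum fps_nth S j) A)"
  by (simp add: has_sum_def tendsto_fps_iff tendsto_discrete fps_sum_nth)

lemma has_sum_fps_Un_disjoint:
  fixes f :: "'a \<Rightarrow> int fps"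
  assumes "(f has_sum x) A" "(f has_sum y) B" "A \<inter> B = {}"
  shows "(f has_sum (x + y)) (A \<union> B)"
  using assms by (auto simp: has_sum_fps_iff intro!: has_sum_Un_disjoint)

text \<open>The prefactor only shifts and scales: every coefficient of the product is zero or
  \<open>s\<close> times a single earlier coefficient, so it becomes constant as soon as that one
  does.\<close>

lemma has_sum_signed_qpow_mult:
  assumes "(f has_sum x) A"
  shows "((\<lambda>n. signed_qpow s m * f n) has_sum (signed_qpow s m * x)) A"
proof -
  have "(\<lambda>F. \<Sum>n\<in>F. signed_qpow s m * f n) = (\<lambda>F. signed_qpow s m * sum f F)"
    by (simp add: sum_distrib_left)
  moreover have "((\<lambda>F. signed_qpow s m * sum f F) \<longlongrightarrow> signed_qpow s m * x) (finite_subsets_at_top A)"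
    using assms unfolding has_sum_def tendsto_fps_iff signed_qpow_def
    by (auto simp: mult.assoc fps_X_power_mult_nth elim!: allE eventually_mono)
  ultimately show ?thesis
    by (simp add: has_sum_def)
qed

text \<open>Meant for \<open>p\<close> listing the even and \<open>r\<close> the odd indices of a
  half-line \<open>C\<close>. The sets \<open>A\<close> and \<open>B\<close> are kept separate
  because \<open>r\<close> may reverse direction, so that they are opposite half-lines.\<close>

lemma has_sum_image_Un_image:
  fixes f :: "'a \<Rightarrow> int fps"
  assumes "(g has_sum x) A" "(h has_sum y) B"
    and "\<And>m. f (p m) = g m" "\<And>m. f (r m) = h m"
    and "inj p" "inj r" "range p \<inter> range r = {}" "C = p ` A \<union> r ` B"
  shows "(f has_sum (x + y)) C"
proof -
  have "(f has_sum x) (p ` A)" "(f has_sum y) (r ` B)"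
    using assms by (auto simp: has_sum_reindex inj_on_subset o_def)
  then show ?thesis
    unfolding \<open>C = p ` A \<union> r ` B\<close>
    by (rule has_sum_fps_Un_disjoint) (use assms(7) in blast)
qed

lemma signed_qpow_mult:
  assumes "m \<ge> 0" "n \<ge> 0"
  shows "signed_qpow s m * signed_qpow t n = signed_qpow (s * t) (m + n)"
  using assms
  by (simp add: signed_qpow_def nat_add_distrib power_add ac_simps flip: fps_const_mult)

text \<open>With \<open>u\<close> and \<open>v\<close> supplied from outside and the signs reduced
  to parities, comparing two terms needs neither division nor powers: what remains is a polynomial
  identity of exponents and a parity check.\<close>

lemma Psi_term_eq_signed_qpow:
  assumes "s \<in> {1, -1}" "t \<in> {1, -1}" "k \<ge> 0" "l \<ge> 0"
    and u: "n * (n + 1) = 2 * u" and v: "n * (n - 1) = 2 * v"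
  shows "Psi_term (signed_qpow s k) (signed_qpow t l) n =
           signed_qpow ((if even u then 1 else s) * (if even v then 1 else t)) (k * u + l * v)"
proof -
  have uv: "n * (n + 1) div 2 = u" "n * (n - 1) div 2 = v"
    using u v by simp_all
  have nonneg: "u \<ge> 0" "v \<ge> 0"
    using u v zero_le_mult_iff[of n "n + 1"] zero_le_mult_iff[of n "n - 1"] by linarith+
  have "w ^ nat i = (if even i then 1 else w)" if "w \<in> {1, -1}" "i \<ge> 0" for w i :: int
    using that by (auto simp: even_nat_iff)
  with assms(1,2) nonneg show ?thesis
    unfolding Psi_term_signed_qpow uv
    using assms(3,4) by (simp add: signed_qpow_def nat_add_distrib nat_mult_distrib)
qed

lemma signed_qpow_mult_Psi_term:
  assumes "s \<in> {1, -1}" "t \<in> {1, -1}" "k \<ge> 0" "l \<ge> 0" "m \<ge> 0"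
    and "n * (n + 1) = 2 * u" and "n * (n - 1) = 2 * v"
  shows "signed_qpow c m * Psi_term (signed_qpow s k) (signed_qpow t l) n =
           signed_qpow (c * ((if even u then 1 else s) * (if even v then 1 else t)))
             (m + (k * u + l * v))"
proof -
  have "u \<ge> 0" "v \<ge> 0"
    using assms(6,7) zero_le_mult_iff[of n "n + 1"] zero_le_mult_iff[of n "n - 1"] by linarith+
  with assms show ?thesis
    by (simp add: Psi_term_eq_signed_qpow signed_qpow_mult del: insert_iff)
qed

text \<open>All triangular numbers that occur below are linear in \<open>w\<close> and
  \<open>m\<close>, by substituting m^2 = 2w - m.\<close>

lemma triangularE:
  fixes m :: int
  obtains w where "m * (m + 1) = 2 * w" "m * (m - 1) = 2 * (w - m)"
proof
  show "m * (m + 1) = 2 * (m * (m + 1) div 2)"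
    by simp
  then show "m * (m - 1) = 2 * (m * (m + 1) div 2 - m)"
    by (simp add: algebra_simps)
qed

context
  fixes \<epsilon> s a b :: int
  assumes eps: "\<epsilon> \<in> {1, -1}" and s: "s \<in> {1, -1}" and nonneg: "a \<ge> 0" "b \<ge> 0"
begin

lemma s_eps: "s * \<epsilon> \<in> {1, -1}"
  using eps s by auto

lemma Psi_term_even:
  "Psi_term (signed_qpow s a) (signed_qpow (s * \<epsilon>) b) (2 * m) =
     Psi_term (signed_qpow \<epsilon> (3 * a + b)) (signed_qpow \<epsilon> (a + 3 * b)) m"
proof -
  obtain w where w: "m * (m + 1) = 2 * w" "m * (m - 1) = 2 * (w - m)"
    by (rule triangularE)
  have w': "2 * m * (2 * m + 1) = 2 * (4 * w - m)" "2 * m * (2 * m - 1) = 2 * (4 * w - 3 * m)"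
    using w by (simp_all add: algebra_simps)
  have k: "3 * a + b \<ge> 0" "a + 3 * b \<ge> 0"
    using nonneg by auto
  show ?thesis
    unfolding Psi_term_eq_signed_qpow[OF s s_eps nonneg w'] Psi_term_eq_signed_qpow[OF eps eps k w]
    \<comment> \<open>Exponents: a(4w - m) + b(4w - 3m) = (3a + b)w + (a + 3b)(w - m). Signs: 4w - m
      and 4w - 3m have the parity of m, so the factors \<open>s\<close> cancel and both sides carry
      \<epsilon>^m.\<close>
    by (rule arg_cong2[where f = signed_qpow]) (use eps s in \<open>auto simp: algebra_simps\<close>)
qed

lemma Psi_term_odd_less:
  assumes "a < b"
  shows "Psi_term (signed_qpow s a) (signed_qpow (s * \<epsilon>) b) (2 * m + 1) =
     signed_qpow s a * Psi_term (signed_qpow \<epsilon> (5 * a + 3 * b)) (signed_qpow \<epsilon> (b - a)) m"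
proof -
  obtain w where w: "m * (m + 1) = 2 * w" "m * (m - 1) = 2 * (w - m)"
    by (rule triangularE)
  have w': "(2 * m + 1) * (2 * m + 1 + 1) = 2 * (4 * w + m + 1)"
    "(2 * m + 1) * (2 * m + 1 - 1) = 2 * (4 * w - m)"
    using w by (simp_all add: algebra_simps)
  have k: "5 * a + 3 * b \<ge> 0" "b - a \<ge> 0"
    using nonneg assms by auto
  show ?thesis
    unfolding Psi_term_eq_signed_qpow[OF s s_eps nonneg w']
      signed_qpow_mult_Psi_term[OF eps eps k nonneg(1) w]
    \<comment> \<open>Here 4w + m + 1 and 4w - m have opposite parity, so exactly one factor
      \<open>s\<close> survives; it is the sign of the prefactor.\<close>
    by (rule arg_cong2[where f = signed_qpow]) (use eps s in \<open>auto simp: algebra_simps\<close>)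
qed

text \<open>This mirrors \<open>Psi_term_odd_less\<close>: replacing n by -n swaps the two
  triangular numbers, hence the two arguments of \<open>Psi_term\<close>, so a and b trade places
  and \<open>s * \<epsilon>\<close> takes the role of \<open>s\<close>.\<close>

lemma Psi_term_odd_greater:
  assumes "b < a"
  shows "Psi_term (signed_qpow s a) (signed_qpow (s * \<epsilon>) b) (- 2 * m - 1) =
     signed_qpow (s * \<epsilon>) b * Psi_term (signed_qpow \<epsilon> (3 * a + 5 * b)) (signed_qpow \<epsilon> (a - b)) m"
proof -
  obtain w where w: "m * (m + 1) = 2 * w" "m * (m - 1) = 2 * (w - m)"
    by (rule triangularE)
  have w': "(- 2 * m - 1) * (- 2 * m - 1 + 1) = 2 * (4 * w - m)"
    "(- 2 * m - 1) * (- 2 * m - 1 - 1) = 2 * (4 * w + m + 1)"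
    using w by (simp_all add: algebra_simps)
  have k: "3 * a + 5 * b \<ge> 0" "a - b \<ge> 0"
    using nonneg assms by auto
  show ?thesis
    unfolding Psi_term_eq_signed_qpow[OF s s_eps nonneg w']
      signed_qpow_mult_Psi_term[OF eps eps k nonneg(2) w]
    by (rule arg_cong2[where f = signed_qpow]) (use eps s in \<open>auto simp: algebra_simps\<close>)
qed

lemma Psi_split_less:
  assumes "a < b"
  shows "Psi (signed_qpow s a) (signed_qpow (s * \<epsilon>) b) =
    Psi (signed_qpow \<epsilon> (3 * a + b)) (signed_qpow \<epsilon> (a + 3 * b)) +
    signed_qpow s a * Psi (signed_qpow \<epsilon> (5 * a + 3 * b)) (signed_qpow \<epsilon> (b - a))"
proof -
  let ?f = "Psi_term (signed_qpow s a) (signed_qpow (s * \<epsilon>) b)"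
  let ?g = "Psi_term (signed_qpow \<epsilon> (3 * a + b)) (signed_qpow \<epsilon> (a + 3 * b))"
  let ?h = "Psi_term (signed_qpow \<epsilon> (5 * a + 3 * b)) (signed_qpow \<epsilon> (b - a))"
  \<comment> \<open>Strictness of a < b gives b > 0, so neither pair of exponents vanishes. The sums
    of \<open>?f\<close> are then derived from these two.\<close>
  have g: "(?g has_sum infsum ?g A) A" and h: "(?h has_sum infsum ?h A) A" for A
    by (intro has_sum_infsum Psi_term_summable; use nonneg assms in auto)+
  have parity: "range (\<lambda>m::int. 2 * m) \<inter> range (\<lambda>m. 2 * m + 1) = {}"
    by auto presburger
  \<comment> \<open>Both maps preserve the half-lines; the boundary index -1 is 2m + 1 at m =
    -1.\<close>
  have sets: "{0..} = (\<lambda>m::int. 2 * m) ` {0..} \<union> (\<lambda>m. 2 * m + 1) ` {0..}"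
    "{..-1} = (\<lambda>m::int. 2 * m) ` {..-1} \<union> (\<lambda>m. 2 * m + 1) ` {..-1}"
    by (auto simp: image_iff Bex_def) presburger+
  note split = has_sum_image_Un_image[where f = ?f, OF _ has_sum_signed_qpow_mult
      Psi_term_even Psi_term_odd_less[OF assms] _ _ parity]
  have "infsum ?f {0..} = infsum ?g {0..} + signed_qpow s a * infsum ?h {0..}"
    "infsum ?f {..-1} = infsum ?g {..-1} + signed_qpow s a * infsum ?h {..-1}"
    by (rule infsumI, rule split[OF g h _ _ sets(1)] split[OF g h _ _ sets(2)]; simp add: inj_on_def)+
  then show ?thesis
    by (simp add: Psi_def algebra_simps)
qed

lemma Psi_split_greater:
  assumes "b < a"
  shows "Psi (signed_qpow s a) (signed_qpow (s * \<epsilon>) b) =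
    Psi (signed_qpow \<epsilon> (3 * a + b)) (signed_qpow \<epsilon> (a + 3 * b)) -
    signed_qpow (s * \<epsilon>) b * Psi (signed_qpow \<epsilon> (3 * a + 5 * b)) (signed_qpow \<epsilon> (a - b))"
proof -
  let ?f = "Psi_term (signed_qpow s a) (signed_qpow (s * \<epsilon>) b)"
  let ?g = "Psi_term (signed_qpow \<epsilon> (3 * a + b)) (signed_qpow \<epsilon> (a + 3 * b))"
  let ?h = "Psi_term (signed_qpow \<epsilon> (3 * a + 5 * b)) (signed_qpow \<epsilon> (a - b))"
  have g: "(?g has_sum infsum ?g A) A" and h: "(?h has_sum infsum ?h A) A" for A
    by (intro has_sum_infsum Psi_term_summable; use nonneg assms in auto)+
  have parity: "range (\<lambda>m::int. 2 * m) \<inter> range (\<lambda>m. - 2 * m - 1) = {}"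
    by auto presburger
  \<comment> \<open>Since -2m - 1 is nonnegative exactly when m \<le> -1, the odd indices come from
    the opposite half-line.\<close>
  have sets: "{0..} = (\<lambda>m::int. 2 * m) ` {0..} \<union> (\<lambda>m. - 2 * m - 1) ` {..-1}"
    "{..-1} = (\<lambda>m::int. 2 * m) ` {..-1} \<union> (\<lambda>m. - 2 * m - 1) ` {0..}"
    by (auto simp: image_iff Bex_def) presburger+
  note split = has_sum_image_Un_image[where f = ?f, OF _ has_sum_signed_qpow_mult
      Psi_term_even Psi_term_odd_greater[OF assms] _ _ parity]
  have "infsum ?f {0..} = infsum ?g {0..} + signed_qpow (s * \<epsilon>) b * infsum ?h {..-1}"
    "infsum ?f {..-1} = infsum ?g {..-1} + signed_qpow (s * \<epsilon>) b * infsum ?h {0..}"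
    by (rule infsumI, rule split[OF g h _ _ sets(1)] split[OF g h _ _ sets(2)]; simp add: inj_on_def)+
  then show ?thesis
    by (simp add: Psi_def algebra_simps)
qed

end

theorem lemma1:
  fixes \<epsilon> s a b :: int
  assumes "\<epsilon> \<in> {1, -1}" and "s \<in> {1, -1}"
  shows "(a > b \<and> b \<ge> 0 \<longrightarrow>
           Psi (signed_qpow s a) (signed_qpow (s * \<epsilon>) b) =
             Psi (signed_qpow \<epsilon> (3 * a + b)) (signed_qpow \<epsilon> (a + 3 * b))
             - signed_qpow (s * \<epsilon>) b *
               Psi (signed_qpow \<epsilon> (3 * a + 5 * b)) (signed_qpow \<epsilon> (a - b))) \<and>
         (b > a \<and> a \<ge> 0 \<longrightarrow>
           Psi (signed_qpow s a) (signed_qpow (s * \<epsilon>) b) =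
             Psi (signed_qpow \<epsilon> (3 * a + b)) (signed_qpow \<epsilon> (a + 3 * b))
             + signed_qpow s a *
               Psi (signed_qpow \<epsilon> (5 * a + 3 * b)) (signed_qpow \<epsilon> (b - a)))"
  using assms Psi_split_less[of \<epsilon> s a b] Psi_split_greater[of \<epsilon> s a b] by auto

end
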